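(* Let $X$ be a locally bounded order complete locally solid $f$-ring with unity and the Fatou property. Then $\mathsf{Hom}^{b}_{nr}(X)$ has the Levi property if and only if $X$ has the Levi property.
   Context: An $\ell$-ring (lattice ring) is a ring which is also a lattice, the additive group being a lattice-ordered group, with $|x\cdot y|\le |x|\cdot|y|$ for all $x,y$. $X_+=\{x\in X: x\ge 0\}$. A set $S\subseteq X$ is solid if $x\in X$, $y\in S$, $|x|\le|y|$ imply $x\in S$. A locally solid $\ell$-ring is an $\ell$-ring that is also a topological ring and has a local basis at zero consisting of solid sets. An $f$-ring is an $\ell$-ring in which $a\wedge b=0$ and $c>0$ imply $ca\wedge b=ac\wedge b=0$; a locally solid $f$-ring is a locally solid $\ell$-ring that is an $f$-ring. Order complete: every non-empty subset that is bounded above has a supremum. A net $(x_\alpha)$ is order convergent to $x$ if there is a net $(z_\beta)$ (possibly over a different index set) with $z_\beta\downarrow 0$ such that for every $\beta$ there is $\alpha_0$ with $|x_\alpha-x|\le z_\beta$ for all $\alpha\ge\alpha_0$. A set is order closed if it contains the limits of all order convergent nets lying in it. $X$ has the Fatou property if its topology has a local basis at zero consisting of solid order closed neighborhoods. A set $B$ in a topological ring is bounded if for each zero neighborhood $W$ there is a zero neighborhood $V$ with $VB\subseteq W$ and $BV\subseteq W$ (sets of products). $X$ is locally bounded if it has a bounded zero neighborhood. A locally solid $\ell$-ring has the Levi property if every bounded upward directed set of positive elements has a supremum. A group homomorphism $T:X\to X$ (of the additive group) is order bounded if it maps order bounded sets (sets contained in an order interval $[u,v]$) to order bounded sets, and $nr$-bounded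 if $T(U)$ is bounded for some zero neighborhood $U\subseteq X$. $\mathsf{Hom}^{b}_{nr}(X)$ is the set of all order bounded $nr$-bounded group homomorphisms $X\to X$, with pointwise addition, composition as multiplication, the order $T\le S$ iff $T(x)\le S(x)$ for all $x\in X_+$ (lattice operations given by Riesz–Kantorovich formulae, in particular $|T|(x)=\sup\{|T(u)|:|u|\le x\}$ for $x\in X_+$), and the topology of uniform convergence on some zero neighborhood: $(S_\alpha)$ converges to $S$ uniformly on a zero neighborhood $U\subseteq X$ if for each zero neighborhood $V\subseteq X$ there is $\alpha_0$ with $(S_\alpha-S)(U)\subseteq V$ for all $\alpha\ge\alpha_0$. It is a locally solid $\ell$-ring. Standing assumption: in every topological group considered (including the additive groups of topological rings), singletons are bounded in the group sense: for each $x$ and each neighborhood $U$ of the identity there is a positive integer $n$ with $x\in nU=\{x_1+\dots+x_n: x_i\in U\}$. *)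

theory Defs
  imports "HOL-Analysis.Analysis" "HOL-Library.Lattice_Algebras"
begin

text \<open>
  The library class \<open>lattice_ring\<close> asks for monotonicity of multiplication by positive elements;
  over a lattice-ordered additive group this is the same as \<open>\<bar>x * y\<bar> \<le> \<bar>x\<bar> * \<bar>y\<bar>\<close>
  (see \<open>abs_le_mult\<close> for one direction; conversely \<open>x, y \<ge> 0\<close> gives
  \<open>0 \<le> \<bar>x * y\<bar> \<le> \<bar>x\<bar> * \<bar>y\<bar> = x * y\<close>).
  A topological \<open>\<ell>\<close>-ring is a type of sort
  \<open>{lattice_ring, topological_ab_group_add, topological_semigroup_mult}\<close>;
  topologies are not assumed to be Hausdorff. A unity is expressed by \<open>monoid_mult\<close>, which does
  not exclude the zero ring, and order completeness by \<open>conditionally_complete_lattice\<close>.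
\<close>

class f_ring = lattice_ring +
  assumes f_ring_mult_left: "inf a b = 0 \<Longrightarrow> 0 < c \<Longrightarrow> inf (c * a) b = 0"
    and f_ring_mult_right: "inf a b = 0 \<Longrightarrow> 0 < c \<Longrightarrow> inf (a * c) b = 0"

definition nbhd_of :: "'a topology \<Rightarrow> 'a \<Rightarrow> 'a set \<Rightarrow> bool" where
  "nbhd_of \<tau> z N \<longleftrightarrow> N \<subseteq> topspace \<tau> \<and> z \<in> \<tau> interior_of N"

abbreviation zero_nbhd :: "'a::{topological_space, zero} set \<Rightarrow> bool" where
  "zero_nbhd \<equiv> nbhd_of euclidean 0"

definition solid :: "'a::lattice_ab_group_add_abs set \<Rightarrow> bool" where
  "solid S \<longleftrightarrow> (\<forall>x y. y \<in> S \<longrightarrow> \<bar>x\<bar> \<le> \<bar>y\<bar> \<longrightarrow> x \<in> S)"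

definition locally_solid :: "'a::lattice_ab_group_add_abs topology \<Rightarrow> bool" where
  "locally_solid \<tau> \<longleftrightarrow> (\<forall>W. nbhd_of \<tau> 0 W \<longrightarrow> (\<exists>N. nbhd_of \<tau> 0 N \<and> N \<subseteq> W \<and> solid N))"

text \<open>
  Nets are represented by a map and a filter on its index type, as for \<open>tendsto\<close>.
  The decreasing net \<open>z\<^sub>\<beta> \<down> 0\<close> enters only through its range, a downward directed set
  with infimum \<open>0\<close>; its index set is unrelated to the filter \<open>F\<close>.
\<close>

definition down_to_zero :: "'a::{order, zero} set \<Rightarrow> bool" where
  "down_to_zero Z \<longleftrightarrow> Z \<noteq> {} \<and> (\<forall>a\<in>Z. \<forall>b\<in>Z. \<exists>c\<in>Z. c \<le> a \<and> c \<le> b) \<and>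
     (\<forall>z\<in>Z. 0 \<le> z) \<and> (\<forall>w. (\<forall>z\<in>Z. w \<le> z) \<longrightarrow> w \<le> 0)"

definition order_tendsto ::
  "('i \<Rightarrow> 'a::lattice_ab_group_add_abs) \<Rightarrow> 'a \<Rightarrow> 'i filter \<Rightarrow> bool" where
  "order_tendsto f x F \<longleftrightarrow>
     (\<exists>Z. down_to_zero Z \<and> (\<forall>z\<in>Z. \<forall>\<^sub>F i in F. \<bar>f i - x\<bar> \<le> z))"

definition order_closed :: "'a::lattice_ab_group_add_abs set \<Rightarrow> bool" where
  "order_closed S \<longleftrightarrow> (\<forall>F x. F \<noteq> bot \<longrightarrow> (\<forall>\<^sub>F y in F. y \<in> S) \<longrightarrow>
     order_tendsto (\<lambda>y. y) x F \<longrightarrow> x \<in> S)"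

definition fatou_property :: "'a::lattice_ab_group_add_abs topology \<Rightarrow> bool" where
  "fatou_property \<tau> \<longleftrightarrow> (\<forall>W. nbhd_of \<tau> 0 W \<longrightarrow>
     (\<exists>N. nbhd_of \<tau> 0 N \<and> N \<subseteq> W \<and> solid N \<and> order_closed N))"

text \<open>
  Equivalently, \<open>order_closed\<close> sets are those closed under order convergent nets over directed
  preordered index sets (\<open>order_closed_net\<close>, \<open>order_closed_if_nets\<close>); the fixed index
  types in the converse direction are large enough to represent every filter.
\<close>

lemma order_closedD:
  assumes "order_closed S" "F \<noteq> bot" "\<forall>\<^sub>F i in F. f i \<in> S" "order_tendsto f x F"
  shows "x \<in> S"
proof -
  have "filtermap f F \<noteq> bot"
    using assms(2) by (simp add: filtermap_bot_iff)
  moreover have "order_tendsto (\<lambda>y. y) x (filtermap f F)"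
    using assms(4) by (simp add: order_tendsto_def eventually_filtermap)
  moreover have "\<forall>\<^sub>F y in filtermap f F. y \<in> S"
    using assms(3) by (simp add: eventually_filtermap)
  ultimately show ?thesis
    using assms(1)[unfolded order_closed_def, rule_format] by blast
qed

definition directed_index :: "'i set \<Rightarrow> ('i \<Rightarrow> 'i \<Rightarrow> bool) \<Rightarrow> bool" where
  "directed_index I le \<longleftrightarrow> I \<noteq> {} \<and> (\<forall>i\<in>I. le i i) \<and>
     (\<forall>i\<in>I. \<forall>j\<in>I. \<forall>k\<in>I. le i j \<longrightarrow> le j k \<longrightarrow> le i k) \<and>
     (\<forall>i\<in>I. \<forall>j\<in>I. \<exists>k\<in>I. le i k \<and> le j k)"

lemma directed_indexD:
  assumes "directed_index I le"
  shows "I \<noteq> {}" and "\<forall>i\<in>I. le i i"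
    and "\<forall>i\<in>I. \<forall>j\<in>I. \<forall>k\<in>I. le i j \<longrightarrow> le j k \<longrightarrow> le i k"
    and "\<forall>i\<in>I. \<forall>j\<in>I. \<exists>k\<in>I. le i k \<and> le j k"
proof -
  note D = assms[unfolded directed_index_def]
  show "I \<noteq> {}" by (rule D[THEN conjunct1])
  show "\<forall>i\<in>I. le i i" by (rule D[THEN conjunct2, THEN conjunct1])
  show "\<forall>i\<in>I. \<forall>j\<in>I. \<forall>k\<in>I. le i j \<longrightarrow> le j k \<longrightarrow> le i k"
    by (rule D[THEN conjunct2, THEN conjunct2, THEN conjunct1])
  show "\<forall>i\<in>I. \<forall>j\<in>I. \<exists>k\<in>I. le i k \<and> le j k"
    by (rule D[THEN conjunct2, THEN conjunct2, THEN conjunct2])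
qed

definition net_order_convergent ::
  "'i set \<Rightarrow> ('i \<Rightarrow> 'i \<Rightarrow> bool) \<Rightarrow> ('i \<Rightarrow> 'a::lattice_ab_group_add_abs) \<Rightarrow> 'a \<Rightarrow>
   'j set \<Rightarrow> ('j \<Rightarrow> 'j \<Rightarrow> bool) \<Rightarrow> ('j \<Rightarrow> 'a) \<Rightarrow> bool" where
  "net_order_convergent I le f x J le' z \<longleftrightarrow>
     (\<forall>b\<in>J. \<forall>c\<in>J. le' b c \<longrightarrow> z c \<le> z b) \<and>
     (\<forall>b\<in>J. 0 \<le> z b) \<and> (\<forall>w. (\<forall>b\<in>J. w \<le> z b) \<longrightarrow> w \<le> 0) \<and>
     (\<forall>b\<in>J. \<exists>i\<in>I. \<forall>j\<in>I. le i j \<longrightarrow> \<bar>f j - x\<bar> \<le> z b)"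

lemma order_closed_net:
  assumes S: "order_closed S" and I: "directed_index I le" and J: "directed_index J le'"
    and f: "\<forall>i\<in>I. f i \<in> S" and conv: "net_order_convergent I le f x J le' z"
  shows "x \<in> S"
proof -
  define F where "F = (INF i\<in>I. principal {j\<in>I. le i j})"
  have ev: "eventually P F \<longleftrightarrow> (\<exists>i\<in>I. \<forall>j\<in>I. le i j \<longrightarrow> P j)" for P
  proof -
    have "eventually P F \<longleftrightarrow> (\<exists>i\<in>I. eventually P (principal {j\<in>I. le i j}))"
      unfolding F_def
    proof (rule eventually_INF_base)
      show "I \<noteq> {}" using directed_indexD(1)[OF I] .
      show "\<exists>k\<in>I. principal {j \<in> I. le k j}
              \<le> inf (principal {j \<in> I. le a j}) (principal {j \<in> I. le b j})"
        if "a \<in> I" "b \<in> I" for a b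
      proof -
        have "\<exists>k\<in>I. le a k \<and> le b k"
          using directed_indexD(4)[OF I] that by simp
        then obtain k where k: "k \<in> I" "le a k" "le b k" by blast
        have "{j \<in> I. le k j} \<subseteq> {j \<in> I. le a j} \<inter> {j \<in> I. le b j}"
          using directed_indexD(3)[OF I, rule_format, OF that(1) k(1) _ k(2)]
            directed_indexD(3)[OF I, rule_format, OF that(2) k(1) _ k(3)] by blast
        then show ?thesis
          using k(1) by (intro bexI[of _ k]) simp_all
      qed
    qed
    then show ?thesis by (auto simp: eventually_principal)
  qed
  have "F \<noteq> bot"
    unfolding trivial_limit_def ev using directed_indexD(1,2)[OF I] by blast
  moreover have "\<forall>\<^sub>F i in F. f i \<in> S"
    unfolding ev using directed_indexD(1)[OF I] f by blast
  moreover have "order_tendsto f x F"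
  proof -
    have anti: "\<And>b c. b \<in> J \<Longrightarrow> c \<in> J \<Longrightarrow> le' b c \<Longrightarrow> z c \<le> z b"
      and pos: "\<And>b. b \<in> J \<Longrightarrow> 0 \<le> z b" and inf: "\<And>w. \<forall>b\<in>J. w \<le> z b \<Longrightarrow> w \<le> 0"
      and lim: "\<And>b. b \<in> J \<Longrightarrow> \<forall>\<^sub>F i in F. \<bar>f i - x\<bar> \<le> z b"
      using conv by (simp_all add: net_order_convergent_def ev)
    have "\<exists>c\<in>z ` J. c \<le> z a \<and> c \<le> z b" if "a \<in> J" "b \<in> J" for a b
    proof -
      obtain c where c: "c \<in> J" "le' a c" "le' b c"
        using directed_indexD(4)[OF J] \<open>a \<in> J\<close> \<open>b \<in> J\<close> by metis
      then show ?thesis using anti[OF that(1) c(1,2)] anti[OF that(2) c(1,3)] by blast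
    qed
    then have "down_to_zero (z ` J)"
      using directed_indexD(1)[OF J] pos inf by (simp add: down_to_zero_def)
    then show ?thesis
      unfolding order_tendsto_def using lim by blast
  qed
  ultimately show ?thesis
    by (rule order_closedD[OF S, where F = F and f = f and x = x])
qed

lemma order_closed_if_nets:
  fixes S :: "'a::lattice_ab_group_add_abs set"
  assumes *: "\<And>(I :: ('a set \<times> 'a) set) le f x (J :: 'a set) le' z.
      \<lbrakk>directed_index I le; directed_index J le'; \<forall>i\<in>I. f i \<in> S;
       net_order_convergent I le f x J le' z\<rbrakk> \<Longrightarrow> x \<in> S"
  shows "order_closed S"
  unfolding order_closed_def
proof (intro allI impI)
  fix F :: "'a filter" and x
  assume nb: "F \<noteq> bot" and FS: "\<forall>\<^sub>F y in F. y \<in> S" and "order_tendsto (\<lambda>y. y) x F"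
  then obtain Z where Z: "down_to_zero Z" "\<And>z. z \<in> Z \<Longrightarrow> \<forall>\<^sub>F y in F. \<bar>y - x\<bar> \<le> z"
    by (auto simp: order_tendsto_def)
  define I where "I = {(A, y). (\<forall>\<^sub>F u in F. u \<in> A) \<and> A \<subseteq> S \<and> y \<in> A}"
  define le where "le p q \<longleftrightarrow> fst q \<subseteq> fst p" for p q :: "'a set \<times> 'a"
  have ne: "\<exists>y. y \<in> A" if "\<forall>\<^sub>F u in F. u \<in> A" for A
    using eventually_happens'[OF nb that] .
  show "x \<in> S"
  proof (rule *)
    show "directed_index I le"
      unfolding directed_index_def
    proof (intro conjI ballI impI)
      obtain y where "y \<in> S" using ne[OF FS] by blast
      then show "I \<noteq> {}" using FS by (auto simp: I_def)
      fix p q assume "p \<in> I" "q \<in> I"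
      then have ev: "\<forall>\<^sub>F u in F. u \<in> fst p \<inter> fst q" and sub: "fst p \<inter> fst q \<subseteq> S"
        by (auto simp: I_def eventually_conj)
      obtain y where "y \<in> fst p \<inter> fst q" using ne[OF ev] by blast
      then have "(fst p \<inter> fst q, y) \<in> I" using ev sub by (simp add: I_def)
      then show "\<exists>k\<in>I. le p k \<and> le q k" 
        by (intro bexI[of _ "(fst p \<inter> fst q, y)"]) (simp_all add: le_def)
    qed (auto simp: le_def)
    show "directed_index Z (\<lambda>a b. b \<le> a)"
      using Z(1) unfolding directed_index_def down_to_zero_def
      by (intro conjI ballI impI) auto
    show "\<forall>i\<in>I. snd i \<in> S" by (auto simp: I_def)
    show "net_order_convergent I le snd x Z (\<lambda>a b. b \<le> a) (\<lambda>z. z)"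
      unfolding net_order_convergent_def
    proof (intro conjI ballI)
      fix z assume "z \<in> Z"
      then have ev: "\<forall>\<^sub>F y in F. y \<in> S \<inter> {y. \<bar>y - x\<bar> \<le> z}"
        using FS Z(2) by (auto simp: eventually_conj)
      obtain y where "y \<in> S \<inter> {y. \<bar>y - x\<bar> \<le> z}" using ne[OF ev] by blast
      then have "(S \<inter> {y. \<bar>y - x\<bar> \<le> z}, y) \<in> I" using ev by (simp add: I_def)
      moreover have "\<forall>j\<in>I. le (S \<inter> {y. \<bar>y - x\<bar> \<le> z}, y) j \<longrightarrow> \<bar>snd j - x\<bar> \<le> z"
        by (auto simp: I_def le_def)
      ultimately show "\<exists>i\<in>I. \<forall>j\<in>I. le i j \<longrightarrow> \<bar>snd j - x\<bar> \<le> z" by blast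
    qed (use Z(1) in \<open>auto simp: down_to_zero_def\<close>)
  qed
qed

text \<open>
  These notions are needed both for a ring given by a type and for the ring of homomorphisms
  below, whose elements form a proper subset of a type. They therefore take the topology
  (its \<open>topspace\<close> is the carrier), the zero, the multiplication and the order as parameters.
\<close>

definition ring_bounded :: "'a topology \<Rightarrow> 'a \<Rightarrow> ('a \<Rightarrow> 'a \<Rightarrow> 'a) \<Rightarrow> 'a set \<Rightarrow> bool" where
  "ring_bounded \<tau> z m B \<longleftrightarrow> B \<subseteq> topspace \<tau> \<and>
     (\<forall>W. nbhd_of \<tau> z W \<longrightarrow>
       (\<exists>V. nbhd_of \<tau> z V \<and> (\<forall>v\<in>V. \<forall>b\<in>B. m v b \<in> W \<and> m b v \<in> W)))"

definition locally_bounded :: "'a topology \<Rightarrow> 'a \<Rightarrow> ('a \<Rightarrow> 'a \<Rightarrow> 'a) \<Rightarrow> bool" where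
  "locally_bounded \<tau> z m \<longleftrightarrow> (\<exists>N. nbhd_of \<tau> z N \<and> ring_bounded \<tau> z m N)"

definition is_supremum :: "'a set \<Rightarrow> ('a \<Rightarrow> 'a \<Rightarrow> bool) \<Rightarrow> 'a set \<Rightarrow> 'a \<Rightarrow> bool" where
  "is_supremum C le D s \<longleftrightarrow>
     s \<in> C \<and> (\<forall>x\<in>D. le x s) \<and> (\<forall>u\<in>C. (\<forall>x\<in>D. le x u) \<longrightarrow> le s u)"

definition upward_directed :: "('a \<Rightarrow> 'a \<Rightarrow> bool) \<Rightarrow> 'a set \<Rightarrow> bool" where
  "upward_directed le D \<longleftrightarrow> D \<noteq> {} \<and> (\<forall>x\<in>D. \<forall>y\<in>D. \<exists>w\<in>D. le x w \<and> le y w)"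

definition levi_property ::
  "'a topology \<Rightarrow> 'a \<Rightarrow> ('a \<Rightarrow> 'a \<Rightarrow> 'a) \<Rightarrow> ('a \<Rightarrow> 'a \<Rightarrow> bool) \<Rightarrow> bool" where
  "levi_property \<tau> z m le \<longleftrightarrow>
     (\<forall>D. ring_bounded \<tau> z m D \<longrightarrow> upward_directed le D \<longrightarrow> (\<forall>x\<in>D. le z x) \<longrightarrow>
       (\<exists>s. is_supremum (topspace \<tau>) le D s))"

text \<open>\<open>nfold_sum n U\<close> is the \<open>n\<close>-fold sumset of \<open>U\<close>, not the set of multiples of elements of \<open>U\<close>.\<close>

definition nfold_sum :: "nat \<Rightarrow> 'a::comm_monoid_add set \<Rightarrow> 'a set" where
  "nfold_sum n U = {sum x {..<n} |x. \<forall>i<n. x i \<in> U}"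

definition singletons_group_bounded :: "'a::comm_monoid_add topology \<Rightarrow> bool" where
  "singletons_group_bounded \<tau> \<longleftrightarrow>
     (\<forall>x\<in>topspace \<tau>. \<forall>U. nbhd_of \<tau> 0 U \<longrightarrow> (\<exists>n>0. x \<in> nfold_sum n U))"

definition order_bounded :: "'a::order set \<Rightarrow> bool" where
  "order_bounded A \<longleftrightarrow> (\<exists>u v. A \<subseteq> {u..v})"

definition order_bounded_map :: "('a::order \<Rightarrow> 'a) \<Rightarrow> bool" where
  "order_bounded_map T \<longleftrightarrow> (\<forall>A. order_bounded A \<longrightarrow> order_bounded (T ` A))"

definition nr_bounded :: "('a::{topological_space, ring} \<Rightarrow> 'a) \<Rightarrow> bool" where
  "nr_bounded T \<longleftrightarrow> (\<exists>U. zero_nbhd U \<and> ring_bounded euclidean 0 (*) (T ` U))"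

definition Hom_nr :: "('a::{topological_space, lattice_ring} \<Rightarrow> 'a) set" where
  "Hom_nr = {T. Modules.additive T \<and> order_bounded_map T \<and> nr_bounded T}"

definition hom_le :: "('a::{zero, ord} \<Rightarrow> 'a) \<Rightarrow> ('a \<Rightarrow> 'a) \<Rightarrow> bool" where
  "hom_le T S \<longleftrightarrow> (\<forall>x\<ge>0. T x \<le> S x)"

definition converges_uniformly_on ::
  "'a set \<Rightarrow> ('i \<Rightarrow> 'a \<Rightarrow> 'a::{topological_space, ab_group_add}) \<Rightarrow> ('a \<Rightarrow> 'a) \<Rightarrow> 'i filter \<Rightarrow> bool"
  where
  "converges_uniformly_on U f S F \<longleftrightarrow>
     (\<forall>V. zero_nbhd V \<longrightarrow> (\<forall>\<^sub>F i in F. \<forall>x\<in>U. f i x - S x \<in> V))"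

text \<open>
  The topology of uniform convergence on some zero neighbourhood is the finest one in which
  every net converging uniformly on some zero neighbourhood converges: \<open>N\<close> is open iff it is open
  for uniform convergence on \<open>U\<close>, for each zero neighbourhood \<open>U\<close>. Over a locally bounded
  ring with unity in which singletons are bounded in the additive group, the convergent nets are exactly those converging uniformly on some zero
  neighbourhood (\<open>limitin_hom_nr_topology_iff\<close> below).
\<close>

definition hom_nr_open :: "('a::{topological_space, lattice_ring} \<Rightarrow> 'a) set \<Rightarrow> bool" where
  "hom_nr_open N \<longleftrightarrow> N \<subseteq> Hom_nr \<and>
     (\<forall>S\<in>N. \<forall>U. zero_nbhd U \<longrightarrow>
       (\<exists>V. zero_nbhd V \<and> {T \<in> Hom_nr. \<forall>x\<in>U. T x - S x \<in> V} \<subseteq> N))"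

definition hom_nr_topology :: "('a::{topological_space, lattice_ring} \<Rightarrow> 'a) topology" where
  "hom_nr_topology = topology hom_nr_open"

lemma zero_nbhd_iff: "zero_nbhd N \<longleftrightarrow> (\<forall>\<^sub>F x in nhds 0. x \<in> N)"
  by (auto simp: nbhd_of_def eventually_nhds interior_def)

lemma zero_nbhd_Int: "zero_nbhd A \<Longrightarrow> zero_nbhd B \<Longrightarrow> zero_nbhd (A \<inter> B)"
  by (simp add: zero_nbhd_iff eventually_conj)

lemma zero_nbhd_0: "zero_nbhd N \<Longrightarrow> 0 \<in> N"
  using eventually_nhds_x_imp_x zero_nbhd_iff by blast

lemma hom_nr_openD:
  assumes "hom_nr_open N" "S \<in> N" "zero_nbhd U"
  shows "\<exists>V. zero_nbhd V \<and> {T \<in> Hom_nr. \<forall>x\<in>U. T x - S x \<in> V} \<subseteq> N"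
  using assms by (simp add: hom_nr_open_def)

lemma hom_nr_openI:
  assumes "N \<subseteq> Hom_nr"
    and "\<And>S U. S \<in> N \<Longrightarrow> zero_nbhd U \<Longrightarrow>
      \<exists>V. zero_nbhd V \<and> {T \<in> Hom_nr. \<forall>x\<in>U. T x - S x \<in> V} \<subseteq> N"
  shows "hom_nr_open N"
  using assms by (simp add: hom_nr_open_def)

lemma hom_nr_open_subset: "hom_nr_open N \<Longrightarrow> N \<subseteq> Hom_nr"
  by (simp add: hom_nr_open_def)

lemma openin_hom_nr_topology: "openin hom_nr_topology = hom_nr_open"
  unfolding hom_nr_topology_def
proof (rule topology_inverse', unfold istopology_def, intro conjI allI impI)
  fix A B :: "('a \<Rightarrow> 'a) set"
  assume A: "hom_nr_open A" and B: "hom_nr_open B"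
  show "hom_nr_open (A \<inter> B)"
  proof (rule hom_nr_openI)
    show "A \<inter> B \<subseteq> Hom_nr" using hom_nr_open_subset[OF A] by blast
    fix S and U :: "'a set" assume S: "S \<in> A \<inter> B" and U: "zero_nbhd U"
    obtain V where V: "zero_nbhd V" "{T \<in> Hom_nr. \<forall>x\<in>U. T x - S x \<in> V} \<subseteq> A"
      using hom_nr_openD[OF A _ U] S by blast
    obtain V' where V': "zero_nbhd V'" "{T \<in> Hom_nr. \<forall>x\<in>U. T x - S x \<in> V'} \<subseteq> B"
      using hom_nr_openD[OF B _ U] S by blast
    have "{T \<in> Hom_nr. \<forall>x\<in>U. T x - S x \<in> V \<inter> V'} \<subseteq> A \<inter> B"
      using V(2) V'(2) by auto
    then show "\<exists>V. zero_nbhd V \<and> {T \<in> Hom_nr. \<forall>x\<in>U. T x - S x \<in> V} \<subseteq> A \<inter> B"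
      using zero_nbhd_Int[OF V(1) V'(1)] by blast
  qed
next
  fix K :: "('a \<Rightarrow> 'a) set set"
  assume K: "\<forall>A\<in>K. hom_nr_open A"
  show "hom_nr_open (\<Union>K)"
  proof (rule hom_nr_openI)
    show "\<Union>K \<subseteq> Hom_nr" using K hom_nr_open_subset by blast
    fix S and U :: "'a set" assume S: "S \<in> \<Union>K" and U: "zero_nbhd U"
    then obtain A where A: "A \<in> K" "S \<in> A" by blast
    have "hom_nr_open A" using K A(1) by simp
    from hom_nr_openD[OF this A(2) U]
    show "\<exists>V. zero_nbhd V \<and> {T \<in> Hom_nr. \<forall>x\<in>U. T x - S x \<in> V} \<subseteq> \<Union>K"
      using A(1) by (meson Union_upper order_trans)
  qed
qed

lemma topspace_hom_nr_topology: "topspace hom_nr_topology = Hom_nr"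
proof
  show "topspace hom_nr_topology \<subseteq> (Hom_nr :: ('a \<Rightarrow> 'a) set)"
    using openin_topspace[of "hom_nr_topology :: ('a \<Rightarrow> 'a) topology"]
    by (simp only: openin_hom_nr_topology hom_nr_open_subset)
  have "zero_nbhd (UNIV :: 'a set)" by (simp add: zero_nbhd_iff)
  then have "hom_nr_open (Hom_nr :: ('a \<Rightarrow> 'a) set)"
    by (intro hom_nr_openI) auto
  then show "(Hom_nr :: ('a \<Rightarrow> 'a) set) \<subseteq> topspace hom_nr_topology"
    by (simp add: openin_subset openin_hom_nr_topology)
qed

lemma zero_nbhd_add:
  fixes W :: "'a::topological_ab_group_add set"
  assumes "zero_nbhd W"
  shows "\<exists>V. zero_nbhd V \<and> (\<forall>x\<in>V. \<forall>y\<in>V. x + y \<in> W)"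
proof -
  have "\<forall>\<^sub>F p in nhds (0::'a) \<times>\<^sub>F nhds 0. fst p + snd p \<in> W"
    using tendsto_add_Pair[of "0::'a" 0, unfolded filterlim_iff, rule_format, of "\<lambda>x. x \<in> W"] assms
    by (simp add: zero_nbhd_iff)
  then obtain P where "eventually P (nhds (0::'a))" "\<And>x y. P x \<Longrightarrow> P y \<Longrightarrow> x + y \<in> W"
    unfolding eventually_prod_same by auto
  then show ?thesis by (intro exI[of _ "Collect P"]) (auto simp: zero_nbhd_iff)
qed

lemma zero_nbhd_sum:
  fixes W :: "'a::topological_ab_group_add set"
  assumes "zero_nbhd W"
  shows "\<exists>V. zero_nbhd V \<and> (\<forall>x::nat \<Rightarrow> 'a. (\<forall>i<n. x i \<in> V) \<longrightarrow> sum x {..<n} \<in> W)"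
  using assms
proof (induction n arbitrary: W)
  case 0
  then show ?case using zero_nbhd_0 by auto
next
  case (Suc n)
  obtain V where V: "zero_nbhd V" "\<forall>x\<in>V. \<forall>y\<in>V. x + y \<in> W"
    using zero_nbhd_add[OF Suc.prems] by blast
  obtain V' where V': "zero_nbhd V'"
    "\<And>x::nat \<Rightarrow> 'a. (\<forall>i<n. x i \<in> V') \<Longrightarrow> sum x {..<n} \<in> V"
    using Suc.IH[OF V(1)] by blast
  show ?case
    using V V' by (intro exI[of _ "V \<inter> V'"]) (auto intro: zero_nbhd_Int)
qed

lemma ring_bounded_subset_nfold_sum:
  fixes B U :: "'a::{topological_space, ring, monoid_mult} set"
  assumes "singletons_group_bounded (euclidean :: 'a topology)"
    and "ring_bounded euclidean 0 (*) B" and "zero_nbhd U"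
  shows "\<exists>n. B \<subseteq> nfold_sum n U"
proof -
  obtain V where V: "zero_nbhd V" "\<And>v b. v \<in> V \<Longrightarrow> b \<in> B \<Longrightarrow> v * b \<in> U"
    using assms(2,3) unfolding ring_bounded_def by meson
  obtain n where "1 \<in> nfold_sum n V"
    using assms(1) V(1) unfolding singletons_group_bounded_def by fastforce
  then obtain e where e: "1 = sum e {..<n}" "\<And>i. i < n \<Longrightarrow> e i \<in> V"
    by (auto simp: nfold_sum_def)
  have "b \<in> nfold_sum n U" if "b \<in> B" for b
  proof -
    have "b = (\<Sum>i<n. e i * b)"
      by (metis e(1) mult_1 sum_distrib_right)
    then show ?thesis
      unfolding nfold_sum_def using V(2) e(2) that by blast
  qed
  then show ?thesis by blast
qed

lemma limitin_hom_nr_topology_iff: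
  fixes f :: "'i \<Rightarrow> 'a \<Rightarrow>
      'a::{lattice_ring, monoid_mult, topological_ab_group_add, topological_semigroup_mult}"
  assumes lb: "locally_bounded (euclidean :: 'a topology) 0 (*)"
    and sg: "singletons_group_bounded (euclidean :: 'a topology)"
  shows "limitin hom_nr_topology f S F \<longleftrightarrow>
    S \<in> Hom_nr \<and> (\<forall>\<^sub>F i in F. f i \<in> Hom_nr) \<and>
    (\<exists>U. zero_nbhd U \<and> converges_uniformly_on U f S F)"
    (is "?L \<longleftrightarrow> ?R")
proof
  assume R: ?R
  then obtain U where U: "zero_nbhd U" "converges_uniformly_on U f S F" by blast
  show ?L
    unfolding limitin_def topspace_hom_nr_topology openin_hom_nr_topology
  proof (intro conjI allI impI)
    fix N assume "hom_nr_open N \<and> S \<in> N"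
    then obtain V where V: "zero_nbhd V" "{T \<in> Hom_nr. \<forall>x\<in>U. T x - S x \<in> V} \<subseteq> N"
      using hom_nr_openD[OF _ _ U(1)] by blast
    have "\<forall>\<^sub>F i in F. f i \<in> Hom_nr \<and> (\<forall>x\<in>U. f i x - S x \<in> V)"
      using R U(2) V(1) by (simp add: eventually_conj converges_uniformly_on_def)
    then show "\<forall>\<^sub>F i in F. f i \<in> N"
      by (rule eventually_mono) (use V(2) in auto)
  qed (use R in simp)
next
  assume L: ?L
  have S: "S \<in> Hom_nr" and ev: "\<forall>\<^sub>F i in F. f i \<in> Hom_nr"
    using L limitin_topspace[OF L] openin_topspace[of hom_nr_topology]
    by (auto simp: limitin_def topspace_hom_nr_topology)
  obtain U0 :: "'a set" where U0: "zero_nbhd U0" "ring_bounded euclidean 0 (*) U0"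
    using lb unfolding locally_bounded_def by blast
  have "converges_uniformly_on U0 f S F"
    unfolding converges_uniformly_on_def
  proof (intro allI impI)
    fix V :: "'a set" assume V: "zero_nbhd V"
    define N where "N = {S' \<in> Hom_nr. \<exists>V'. zero_nbhd V' \<and>
      (\<forall>T\<in>Hom_nr. (\<forall>x\<in>U0. T x - S' x \<in> V') \<longrightarrow> (\<forall>x\<in>U0. T x - S x \<in> V))}"
    have "hom_nr_open N"
    proof (rule hom_nr_openI)
      show "N \<subseteq> Hom_nr" by (auto simp: N_def)
      fix S' and U :: "'a set" assume S': "S' \<in> N" and U: "zero_nbhd U"
      then obtain V' where V': "zero_nbhd V'"
        "\<And>T. T \<in> Hom_nr \<Longrightarrow> (\<forall>x\<in>U0. T x - S' x \<in> V') \<Longrightarrow> (\<forall>x\<in>U0. T x - S x \<in> V)"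
        unfolding N_def by blast
      obtain W where W: "zero_nbhd W" "\<And>x y. x \<in> W \<Longrightarrow> y \<in> W \<Longrightarrow> x + y \<in> V'"
        using zero_nbhd_add[OF V'(1)] by blast
      obtain n where n: "U0 \<subseteq> nfold_sum n U"
        using ring_bounded_subset_nfold_sum[OF sg U0(2) U] by blast
      obtain W' where W': "zero_nbhd W'"
        "\<And>x::nat \<Rightarrow> 'a. (\<forall>i<n. x i \<in> W') \<Longrightarrow> sum x {..<n} \<in> W"
        using zero_nbhd_sum[OF W(1)] by blast
      have "T \<in> N" if T: "T \<in> Hom_nr" "\<forall>x\<in>U. T x - S' x \<in> W'" for T
      proof -
        have add: "Modules.additive T" "Modules.additive S'"
          using T(1) S' by (auto simp: N_def Hom_nr_def)
        have TS': "T x - S' x \<in> W" if "x \<in> U0" for x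
        proof -
          obtain e where e: "x = sum e {..<n}" "\<forall>i<n. e i \<in> U"
            using subsetD[OF n \<open>x \<in> U0\<close>] by (auto simp: nfold_sum_def)
          have "T x - S' x = (\<Sum>i<n. T (e i) - S' (e i))"
            using add by (simp add: e(1) Modules.additive.sum sum_subtractf)
          then show ?thesis using W'(2) e(2) T(2) by simp
        qed
        have "\<forall>x\<in>U0. T' x - S x \<in> V" if "T' \<in> Hom_nr" "\<forall>x\<in>U0. T' x - T x \<in> W" for T'
        proof -
          have "T' x - S' x \<in> V'" if "x \<in> U0" for x
            using W(2)[of "T' x - T x" "T x - S' x"] TS'[OF that]
              \<open>\<forall>x\<in>U0. T' x - T x \<in> W\<close> that by simp
          then show ?thesis using V'(2) \<open>T' \<in> Hom_nr\<close> by blast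
        qed
        then show ?thesis using T(1) W(1) unfolding N_def by blast
      qed
      then show "\<exists>V. zero_nbhd V \<and> {T \<in> Hom_nr. \<forall>x\<in>U. T x - S' x \<in> V} \<subseteq> N"
        using W'(1) by blast
    qed
    moreover have "S \<in> N" using S V by (auto simp: N_def)
    ultimately have "\<forall>\<^sub>F i in F. f i \<in> N"
      using L by (simp add: limitin_def openin_hom_nr_topology)
    then show "\<forall>\<^sub>F i in F. \<forall>x\<in>U0. f i x - S x \<in> V"
    proof (rule eventually_mono)
      fix i assume "f i \<in> N"
      then show "\<forall>x\<in>U0. f i x - S x \<in> V"
        using zero_nbhd_0 unfolding N_def by force
    qed
  qed
  then show ?R using S ev U0(1) by blast
qed

end

theory Submission
  imports Defs
begin

text \<open>
  Write \<open>L\<^sub>d\<close> for left multiplication by \<open>d\<close>. Each direction uses left multiplications to move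
  boundedness between the ring and its ring of homomorphisms. On the latter the sets of all
  homomorphisms mapping a bounded set into a given zero neighbourhood are zero neighbourhoods, and
  for one fixed bounded zero neighbourhood they form a local basis (\<open>hom_nr_nbhdI\<close>,
  \<open>hom_nr_nbhd_subset\<close>).

  Suppose that the homomorphisms have the Levi property, and let \<open>D\<close> be a bounded upward directed
  set of positive elements. The homomorphisms \<open>L\<^sub>d\<close>, \<open>d \<in> D\<close>, are bounded
  (\<open>bounded_left_mults\<close>), so they have a supremum \<open>S\<close>. Since \<open>0 \<le> 1\<close> in an \<open>f\<close>-ring,
  \<open>L\<^sub>c \<le> L\<^sub>d\<close> is equivalent to \<open>c \<le> d\<close>. Evaluating \<open>L\<^sub>d \<le> S\<close> at \<open>1\<close> shows that \<open>S 1\<close> is an upper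
  bound of \<open>D\<close>; if \<open>u\<close> is another one, then \<open>S \<le> L\<^sub>u\<close>, hence \<open>S 1 \<le> u\<close>.

  Suppose conversely that the ring has the Levi property, and let \<open>D\<close> be a bounded upward directed
  set of positive homomorphisms. The supremum has to be the pointwise one on the positive cone;
  the task is to show that it exists and is \<open>nr\<close>-bounded. Fix a bounded solid order closed zero
  neighbourhood \<open>N\<close>. Testing the boundedness of \<open>D\<close> against left multiplications gives a solid zero
  neighbourhood \<open>E\<close> with \<open>T (e * y) \<in> N\<close> for all \<open>T \<in> D\<close>, \<open>e \<in> E\<close> and \<open>y \<in> N\<close>
  (\<open>uniformly_small_on_products\<close>). Now write \<open>1 = e\<^sub>1 + \<dots> + e\<^sub>n\<close> with \<open>e\<^sub>i \<in> E\<close>. For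
  \<open>y \<in> N\<close> this yields \<open>\<bar>T y\<bar> \<le> T (\<bar>e\<^sub>1\<bar> * \<bar>y\<bar>) + \<dots> + T (\<bar>e\<^sub>n\<bar> * \<bar>y\<bar>)\<close>, where all summands lie in \<open>N\<close>;
  so all \<open>T \<in> D\<close> map \<open>N\<close> into one bounded set \<open>H\<close> (\<open>positive_additive_dominated\<close>). It follows that
  \<open>{T x | T \<in> D}\<close> is bounded for each \<open>x\<close>, so that the pointwise supremum \<open>S\<close> exists on the cone. It
  is additive because \<open>D\<close> is directed. The values \<open>S (\<bar>e\<^sub>i\<bar> * \<bar>y\<bar>)\<close> are suprema of directed
  subsets of the order closed set \<open>N\<close>, so they lie in \<open>N\<close>, and the same estimate, applied to \<open>S\<close>,
  gives \<open>S y \<in> H\<close>. Estimating these values instead of \<open>S y\<close> itself is what makes the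
  Fatou property sufficient: the set \<open>H\<close> is not known to be order closed.
\<close>

section \<open>Positivity of the unity and of additive maps\<close>

text \<open>
  Let \<open>p\<close> and \<open>q\<close> be the positive and the negative part of \<open>1\<close>. Disjoint elements of an \<open>f\<close>-ring
  have product \<open>0\<close>, so \<open>q = q * (p - q) = - (q * q) \<le> 0\<close>.
\<close>

lemma f_ring_zero_le_one: "(0::'a::{f_ring, monoid_mult}) \<le> 1"
proof -
  define p q :: 'a where "p = pprt 1" and "q = pprt (- 1)"
  have one: "1 = p - q"
    using prts[of "1::'a"] by (simp add: p_def q_def pprt_neg)
  have pos: "0 \<le> p" "0 \<le> q" by (simp_all add: p_def q_def)
  have "inf p q = 0"
  proof -
    have "q + inf (p - q) 0 = inf p q" by (simp add: add_inf_distrib_left)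
    moreover have "inf (p - q) 0 = - q"
      unfolding one[symmetric] by (simp add: q_def pprt_neg nprt_def)
    ultimately show ?thesis by simp
  qed
  (* In inf p q = 0, multiply p by q from the left, then q by p from the right:
     q * p is disjoint from itself. *)
  have "q * p = 0"
  proof (cases "p = 0 \<or> q = 0")
    case False
    then have "0 < p" "0 < q" using pos by (auto simp: less_le)
    then have "inf (q * p) q = 0"
      using f_ring_mult_left[OF \<open>inf p q = 0\<close>] by simp
    then have "inf (q * p) (q * p) = 0"
      using f_ring_mult_right[of q "q * p" p] \<open>0 < p\<close> by (simp add: inf_commute)
    then show ?thesis by simp
  qed auto
  moreover have "q = q * p - q * q"
    using one by (metis mult_1_right right_diff_distrib)
  ultimately have "q = - (q * q)" by simp
  then have "q \<le> 0" using pos by (metis mult_nonneg_nonneg neg_le_0_iff_le)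
  then show ?thesis using one pos by simp
qed

lemma additive_mono:
  fixes R :: "'a::lattice_ab_group_add_abs \<Rightarrow> 'a"
  assumes "Modules.additive R" and "\<And>x. 0 \<le> x \<Longrightarrow> 0 \<le> R x" and "x \<le> y"
  shows "R x \<le> R y"
  using assms(2)[of "y - x"] assms(3) by (simp add: Modules.additive.diff[OF assms(1)])

lemma additive_abs_le:
  fixes R :: "'a::lattice_ab_group_add_abs \<Rightarrow> 'a"
  assumes "Modules.additive R" and "\<And>x. 0 \<le> x \<Longrightarrow> 0 \<le> R x"
  shows "\<bar>R x\<bar> \<le> R \<bar>x\<bar>"
proof (rule abs_leI)
  show "R x \<le> R \<bar>x\<bar>" by (rule additive_mono[OF assms abs_ge_self])
  show "- R x \<le> R \<bar>x\<bar>"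
    using additive_mono[OF assms abs_ge_minus_self]
    by (simp add: Modules.additive.minus[OF assms(1)])
qed

lemma positive_additive_order_bounded:
  fixes R :: "'a::lattice_ab_group_add_abs \<Rightarrow> 'a"
  assumes "Modules.additive R" and "\<And>x. 0 \<le> x \<Longrightarrow> 0 \<le> R x"
  shows "order_bounded_map R"
  unfolding order_bounded_map_def order_bounded_def
proof (intro allI impI, elim exE)
  fix A :: "'a set" and u v assume "A \<subseteq> {u..v}"
  then have "R ` A \<subseteq> {R u..R v}"
    using additive_mono[OF assms] by auto
  then show "\<exists>u v. R ` A \<subseteq> {u..v}" by blast
qed

text \<open>
  The extension is \<open>S x = s x\<^sup>+ - s x\<^sup>-\<close>; its additivity is the additivity of \<open>s\<close> applied to the two
  sides of \<open>(x + y)\<^sup>+ + x\<^sup>- + y\<^sup>- = (x + y)\<^sup>- + x\<^sup>+ + y\<^sup>+\<close>.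
\<close>

lemma additive_extension_from_cone:
  fixes s :: "'a::lattice_ab_group_add_abs \<Rightarrow> 'a"
  assumes add: "\<And>x y. 0 \<le> x \<Longrightarrow> 0 \<le> y \<Longrightarrow> s (x + y) = s x + s y"
  shows "\<exists>S. Modules.additive S \<and> (\<forall>x\<ge>0. S x = s x)"
proof -
  define S where "S x = s (pprt x) - s (pprt (- x))" for x
  have s0: "s 0 = 0" using add[of 0 0] by simp
  have parts: "pprt x - pprt (- x) = x" for x :: 'a
    using prts[of x] by (simp add: pprt_neg)
  have "Modules.additive S"
  proof
    fix x y :: 'a
    have "pprt (x + y) + (pprt (- x) + pprt (- y)) = pprt (- (x + y)) + (pprt x + pprt y)"
      using parts[of x] parts[of y] parts[of "x + y"] by (simp add: algebra_simps)
    then have "s (pprt (x + y)) + (s (pprt (- x)) + s (pprt (- y)))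
        = s (pprt (- (x + y))) + (s (pprt x) + s (pprt y))"
      using add by (metis add_nonneg_nonneg zero_le_pprt)
    then show "S (x + y) = S x + S y" by (simp add: S_def algebra_simps)
  qed
  moreover have "S x = s x" if "0 \<le> x" for x using that by (simp add: S_def s0)
  ultimately show ?thesis by blast
qed

section \<open>Bounded sets of a topological lattice ring\<close>

lemma zero_nbhd_mult_const:
  fixes W :: "'a::{topological_semigroup_mult, ring} set"
  assumes "zero_nbhd W"
  shows "\<exists>V. zero_nbhd V \<and> (\<forall>v\<in>V. c * v \<in> W \<and> v * c \<in> W)"
proof (intro exI conjI ballI)
  have "((\<lambda>v. c * v) \<longlongrightarrow> c * 0) (nhds 0)" "((\<lambda>v. v * c) \<longlongrightarrow> 0 * c) (nhds 0)"
    by (intro tendsto_mult tendsto_const filterlim_ident)+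
  then have lim: "filterlim (\<lambda>v. c * v) (nhds 0) (nhds 0)" "filterlim (\<lambda>v. v * c) (nhds 0) (nhds 0)"
    by simp_all
  have "\<forall>\<^sub>F v in nhds 0. c * v \<in> W" "\<forall>\<^sub>F v in nhds 0. v * c \<in> W"
    using lim[unfolded filterlim_iff, rule_format, of "\<lambda>x. x \<in> W"] assms
    by (simp_all add: zero_nbhd_iff)
  then show "zero_nbhd {v. c * v \<in> W \<and> v * c \<in> W}"
    by (simp add: zero_nbhd_iff eventually_conj)
qed auto

lemma ring_boundedD:
  assumes "ring_bounded euclidean 0 (*) B" and "zero_nbhd W"
  shows "\<exists>V. zero_nbhd V \<and> (\<forall>v\<in>V. \<forall>b\<in>B. v * b \<in> W \<and> b * v \<in> W)"
  using assms by (simp add: ring_bounded_def)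

lemma ring_boundedI:
  assumes "\<And>W. zero_nbhd W \<Longrightarrow> \<exists>V. zero_nbhd V \<and> (\<forall>v\<in>V. \<forall>b\<in>B. v * b \<in> W \<and> b * v \<in> W)"
  shows "ring_bounded euclidean 0 (*) B"
  using assms by (simp add: ring_bounded_def)

lemma ring_bounded_subset:
  assumes "ring_bounded euclidean 0 (*) B" and "A \<subseteq> B"
  shows "ring_bounded euclidean 0 (*) A"
proof (rule ring_boundedI)
  fix W :: "'a set" assume "zero_nbhd W"
  from ring_boundedD[OF assms(1) this] show
    "\<exists>V. zero_nbhd V \<and> (\<forall>v\<in>V. \<forall>b\<in>A. v * b \<in> W \<and> b * v \<in> W)"
    using assms(2) by (meson subsetD)
qed

lemma ring_bounded_mult:
  fixes A B :: "'a::{topological_space, ring} set"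
  assumes A: "ring_bounded euclidean 0 (*) A" and B: "ring_bounded euclidean 0 (*) B"
  shows "ring_bounded euclidean 0 (*) {a * b |a b. a \<in> A \<and> b \<in> B}"
proof (rule ring_boundedI)
  fix W :: "'a set" assume W: "zero_nbhd W"
  obtain V1 where V1: "zero_nbhd V1" "\<And>v a. v \<in> V1 \<Longrightarrow> a \<in> A \<Longrightarrow> a * v \<in> W"
    using ring_boundedD[OF A W] by blast
  obtain V2 where V2: "zero_nbhd V2" "\<And>v b. v \<in> V2 \<Longrightarrow> b \<in> B \<Longrightarrow> v * b \<in> W"
    using ring_boundedD[OF B W] by blast
  obtain U1 where U1: "zero_nbhd U1" "\<And>v b. v \<in> U1 \<Longrightarrow> b \<in> B \<Longrightarrow> b * v \<in> V1"
    using ring_boundedD[OF B V1(1)] by blast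
  obtain U2 where U2: "zero_nbhd U2" "\<And>v a. v \<in> U2 \<Longrightarrow> a \<in> A \<Longrightarrow> v * a \<in> V2"
    using ring_boundedD[OF A V2(1)] by blast
  have "v * (a * b) \<in> W \<and> a * b * v \<in> W" if "v \<in> U1 \<inter> U2" "a \<in> A" "b \<in> B" for v a b
    using that U1(2)[of v b] U2(2)[of v a] V1(2)[of "b * v" a] V2(2)[of "v * a" b]
    by (simp add: mult.assoc)
  then show "\<exists>V. zero_nbhd V \<and>
      (\<forall>v\<in>V. \<forall>c\<in>{a * b |a b. a \<in> A \<and> b \<in> B}. v * c \<in> W \<and> c * v \<in> W)"
    using zero_nbhd_Int[OF U1(1) U2(1)] by blast
qed

lemma ring_bounded_singleton:
  fixes c :: "'a::{topological_semigroup_mult, ring}"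
  shows "ring_bounded euclidean 0 (*) {c}"
proof (rule ring_boundedI)
  fix W :: "'a set" assume "zero_nbhd W"
  then show "\<exists>V. zero_nbhd V \<and> (\<forall>v\<in>V. \<forall>b\<in>{c}. v * b \<in> W \<and> b * v \<in> W)"
    using zero_nbhd_mult_const[of W c] by (simp add: conj_commute)
qed

lemma ring_bounded_nfold_sum:
  fixes B :: "'a::{topological_ab_group_add, ring} set"
  assumes "ring_bounded euclidean 0 (*) B"
  shows "ring_bounded euclidean 0 (*) (nfold_sum n B)"
proof (rule ring_boundedI)
  fix W :: "'a set" assume "zero_nbhd W"
  then obtain V where V: "zero_nbhd V"
    "\<And>x::nat \<Rightarrow> 'a. (\<forall>i<n. x i \<in> V) \<Longrightarrow> sum x {..<n} \<in> W"
    using zero_nbhd_sum by blast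
  obtain U where U: "zero_nbhd U" "\<forall>u\<in>U. \<forall>b\<in>B. u * b \<in> V \<and> b * u \<in> V"
    using ring_boundedD[OF assms V(1)] by blast
  show "\<exists>V. zero_nbhd V \<and> (\<forall>v\<in>V. \<forall>b\<in>nfold_sum n B. v * b \<in> W \<and> b * v \<in> W)"
    using U by (intro exI[of _ U])
      (auto simp: nfold_sum_def sum_distrib_left sum_distrib_right intro!: V(2))
qed

lemma locally_solidD:
  fixes W :: "'a::{lattice_ab_group_add_abs, topological_space} set"
  assumes "locally_solid (euclidean :: 'a topology)" and "zero_nbhd W"
  shows "\<exists>N. zero_nbhd N \<and> N \<subseteq> W \<and> solid N"
  using assms unfolding locally_solid_def by blast

lemma solidD: "solid N \<Longrightarrow> y \<in> N \<Longrightarrow> \<bar>x\<bar> \<le> \<bar>y\<bar> \<Longrightarrow> x \<in> N"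
  unfolding solid_def by blast

text \<open>
  If \<open>\<bar>y\<bar> \<le> b\<close>, then \<open>\<bar>v * y\<bar> \<le> \<bar>v\<bar> * b\<close>, and \<open>\<bar>v\<bar>\<close> is as small as \<open>v\<close> in a solid neighbourhood. The
  dominating elements are taken positive because smallness of \<open>v * b\<close> does not obviously pass to
  \<open>\<bar>v\<bar> * \<bar>b\<bar>\<close> in a lattice ring.
\<close>

lemma ring_bounded_dominated:
  fixes B :: "'a::{lattice_ring, topological_ab_group_add} set"
  assumes ls: "locally_solid (euclidean :: 'a topology)"
    and B: "ring_bounded euclidean 0 (*) B" and pos: "\<And>b. b \<in> B \<Longrightarrow> 0 \<le> b"
  shows "ring_bounded euclidean 0 (*) {y. \<exists>b\<in>B. \<bar>y\<bar> \<le> b}"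
proof (rule ring_boundedI)
  fix W :: "'a set" assume "zero_nbhd W"
  then obtain W1 where W1: "zero_nbhd W1" "W1 \<subseteq> W" "solid W1"
    using locally_solidD[OF ls] by blast
  obtain Z where Z: "zero_nbhd Z" "\<And>z b. z \<in> Z \<Longrightarrow> b \<in> B \<Longrightarrow> z * b \<in> W1 \<and> b * z \<in> W1"
    using ring_boundedD[OF B W1(1)] by blast
  obtain V where V: "zero_nbhd V" "V \<subseteq> Z" "solid V"
    using locally_solidD[OF ls Z(1)] by blast
  have "v * y \<in> W \<and> y * v \<in> W" if "v \<in> V" "b \<in> B" "\<bar>y\<bar> \<le> b" for v y b
  proof -
    have b: "0 \<le> b" using pos that(2) .
    have "\<bar>v\<bar> \<in> Z" using solidD[OF V(3) that(1), of "\<bar>v\<bar>"] V(2) by auto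
    then have "\<bar>v\<bar> * b \<in> W1" "b * \<bar>v\<bar> \<in> W1" using Z(2) that(2) by auto
    moreover have "\<bar>v * y\<bar> \<le> \<bar>\<bar>v\<bar> * b\<bar>"
      using order_trans[OF abs_le_mult mult_left_mono[OF that(3), of "\<bar>v\<bar>"]] b by simp
    moreover have "\<bar>y * v\<bar> \<le> \<bar>b * \<bar>v\<bar>\<bar>"
      using order_trans[OF abs_le_mult mult_right_mono[OF that(3), of "\<bar>v\<bar>"]] b by simp
    ultimately show ?thesis using solidD[OF W1(3)] W1(2) by blast
  qed
  then show "\<exists>V. zero_nbhd V \<and> (\<forall>v\<in>V. \<forall>y\<in>{y. \<exists>b\<in>B. \<bar>y\<bar> \<le> b}. v * y \<in> W \<and> y * v \<in> W)"
    using V(1) by blast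
qed

text \<open>
  An upward directed set, viewed as a net indexed by itself, order converges to its supremum \<open>s\<close>;
  the elements \<open>s - a\<close> dominate the distances and decrease to \<open>0\<close>.
\<close>

lemma order_closed_directed_sup:
  fixes A :: "'a::lattice_ab_group_add_abs set"
  assumes S: "order_closed S" and A: "A \<subseteq> S" "upward_directed (\<le>) A"
    and s: "is_supremum UNIV (\<le>) A s"
  shows "s \<in> S"
proof (rule order_closed_net[OF S, where I = A and le = "(\<le>)" and f = "\<lambda>a. a"
      and J = A and le' = "(\<le>)" and z = "\<lambda>a. s - a"])
  show "directed_index A (\<le>)" "directed_index A (\<le>)"
    using A(2) unfolding directed_index_def upward_directed_def by (auto intro: order_trans)
  show "\<forall>a\<in>A. a \<in> S" using A(1) by blast
  have ub: "\<And>a. a \<in> A \<Longrightarrow> a \<le> s" and least: "\<And>u. (\<forall>a\<in>A. a \<le> u) \<Longrightarrow> s \<le> u"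
    using s by (auto simp: is_supremum_def)
  show "net_order_convergent A (\<le>) (\<lambda>a. a) s A (\<le>) (\<lambda>a. s - a)"
    unfolding net_order_convergent_def
  proof (intro conjI ballI allI impI)
    show "w \<le> 0" if "\<forall>b\<in>A. w \<le> s - b" for w
    proof -
      have "\<forall>b\<in>A. b \<le> s - w" using that by (simp add: algebra_simps)
      then show ?thesis using least[of "s - w"] by simp
    qed
    show "\<exists>i\<in>A. \<forall>j\<in>A. i \<le> j \<longrightarrow> \<bar>j - s\<bar> \<le> s - b" if "b \<in> A" for b
      using that ub by (intro bexI[of _ b]) (auto intro!: abs_leI simp: diff_left_mono
          intro: order_trans[of _ 0])
  qed (use ub in \<open>auto simp: diff_left_mono\<close>)
qed

section \<open>The ring of homomorphisms and its zero neighbourhoods\<close>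

lemma left_mult_in_Hom_nr:
  fixes c :: "'a::{lattice_ring, topological_ab_group_add, topological_semigroup_mult}"
  assumes "locally_bounded (euclidean :: 'a topology) 0 (*)"
  shows "(*) c \<in> Hom_nr"
proof -
  have "Modules.additive ((*) c)" by standard (simp add: distrib_left)
  moreover have "order_bounded_map ((*) c)"
    unfolding order_bounded_map_def order_bounded_def
  proof (intro allI impI, elim exE)
    fix A :: "'a set" and u v assume A: "A \<subseteq> {u..v}"
    define b where "b = \<bar>c\<bar> * (\<bar>u\<bar> + \<bar>v\<bar>)"
    have "\<bar>c * x\<bar> \<le> b" if "x \<in> A" for x
    proof -
      have x: "u \<le> x" "x \<le> v" using A that by auto
      have "\<bar>x\<bar> \<le> \<bar>u\<bar> + \<bar>v\<bar>"
      proof (rule abs_leI)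
        show "x \<le> \<bar>u\<bar> + \<bar>v\<bar>"
          using x(2) abs_ge_self[of v] abs_ge_zero[of u] by (meson add_increasing order_trans)
        show "- x \<le> \<bar>u\<bar> + \<bar>v\<bar>"
          using x(1) abs_ge_minus_self[of u] abs_ge_zero[of v]
          by (meson add_increasing2 neg_le_iff_le order_trans)
      qed
      then show ?thesis
        unfolding b_def using order_trans[OF abs_le_mult mult_left_mono] by (metis abs_ge_zero)
    qed
    then have "c * x \<le> b \<and> - b \<le> c * x" if "x \<in> A" for x
      using abs_le_D1[of "c * x" b] abs_le_D2[of "c * x" b] that by (simp add: minus_le_iff)
    then have "(*) c ` A \<subseteq> {- b..b}" by auto
    then show "\<exists>u v. (*) c ` A \<subseteq> {u..v}" by blast
  qed
  moreover have "nr_bounded ((*) c)"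
  proof -
    obtain N :: "'a set" where N: "zero_nbhd N" "ring_bounded euclidean 0 (*) N"
      using assms unfolding locally_bounded_def by blast
    have "ring_bounded euclidean 0 (*) ((*) c ` N)"
      by (rule ring_bounded_subset[OF ring_bounded_mult[OF ring_bounded_singleton N(2)]]) blast
    then show ?thesis using N(1) by (auto simp: nr_bounded_def)
  qed
  ultimately show ?thesis by (simp add: Hom_nr_def)
qed

lemma hom_nr_nbhd_subset:
  assumes "nbhd_of hom_nr_topology (\<lambda>_. 0) W" and "zero_nbhd U"
  shows "\<exists>V. zero_nbhd V \<and> {T \<in> Hom_nr. \<forall>x\<in>U. T x \<in> V} \<subseteq> W"
proof -
  have "hom_nr_open (hom_nr_topology interior_of W)"
    by (metis openin_hom_nr_topology openin_interior_of)
  moreover have "(\<lambda>_. 0) \<in> hom_nr_topology interior_of W"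
    using assms(1) by (simp add: nbhd_of_def)
  ultimately obtain V where "zero_nbhd V"
    "{T \<in> Hom_nr. \<forall>x\<in>U. T x - 0 \<in> V} \<subseteq> hom_nr_topology interior_of W"
    using hom_nr_openD[OF _ _ assms(2)] by blast
  then show ?thesis
    using interior_of_subset[of hom_nr_topology W] by (intro exI[of _ V]) auto
qed

text \<open>
  The filter of neighbourhoods of zero in the ring of homomorphisms converges to zero, hence
  uniformly so on some zero neighbourhood \<open>U'\<close> (\<open>limitin_hom_nr_topology_iff\<close>). The bounded set
  \<open>U\<close> is contained in a sumset of \<open>U'\<close>, and additive maps that are uniformly small on \<open>U'\<close> are
  uniformly small on its sumsets.
\<close>

lemma hom_nr_nbhdI:
  fixes U V :: "'a::{lattice_ring, monoid_mult, topological_ab_group_add,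
    topological_semigroup_mult} set"
  assumes lb: "locally_bounded (euclidean :: 'a topology) 0 (*)"
    and sg: "singletons_group_bounded (euclidean :: 'a topology)"
    and U: "ring_bounded euclidean 0 (*) U" and V: "zero_nbhd V"
  shows "nbhd_of hom_nr_topology (\<lambda>_. 0) {T \<in> Hom_nr. \<forall>x\<in>U. T x \<in> V}"
proof -
  let ?F = "nhdsin hom_nr_topology ((\<lambda>_. 0) :: 'a \<Rightarrow> 'a)"
  have "(*) (0::'a) = (\<lambda>_. 0)" by auto
  then have "(\<lambda>_. 0 :: 'a) \<in> Hom_nr" using left_mult_in_Hom_nr[OF lb, of 0] by metis
  then have zero: "(\<lambda>_. 0 :: 'a) \<in> topspace hom_nr_topology"
    by (simp add: topspace_hom_nr_topology)
  then have "limitin hom_nr_topology (\<lambda>T. T) (\<lambda>_. 0 :: 'a) ?F"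
    by (auto simp: limitin_def eventually_nhdsin)
  then obtain U' :: "'a set" where U': "zero_nbhd U'"
    "converges_uniformly_on U' (\<lambda>T. T) (\<lambda>_. 0) ?F" and hom: "\<forall>\<^sub>F T in ?F. T \<in> Hom_nr"
    using limitin_hom_nr_topology_iff[OF lb sg] by blast
  obtain n where n: "U \<subseteq> nfold_sum n U'"
    using ring_bounded_subset_nfold_sum[OF sg U U'(1)] by blast
  obtain V' where V': "zero_nbhd V'"
    "\<And>x::nat \<Rightarrow> 'a. (\<forall>i<n. x i \<in> V') \<Longrightarrow> sum x {..<n} \<in> V"
    using zero_nbhd_sum[OF V] by blast
  have "\<forall>\<^sub>F T in ?F. T \<in> Hom_nr \<and> (\<forall>x\<in>U'. T x \<in> V')"
    using U'(2) V'(1) hom by (auto simp: converges_uniformly_on_def eventually_conj)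
  then have "\<forall>\<^sub>F T in ?F. T \<in> {T \<in> Hom_nr. \<forall>x\<in>U. T x \<in> V}"
  proof (rule eventually_mono)
    fix T :: "'a \<Rightarrow> 'a" assume T: "T \<in> Hom_nr \<and> (\<forall>x\<in>U'. T x \<in> V')"
    have "T x \<in> V" if x: "x \<in> U" for x
    proof -
      obtain e where "x = sum e {..<n}" "\<forall>i<n. e i \<in> U'"
        using subsetD[OF n x] by (auto simp: nfold_sum_def)
      then show ?thesis
        using T V'(2)[of "\<lambda>i. T (e i)"] by (simp add: Hom_nr_def Modules.additive.sum)
    qed
    then show "T \<in> {T \<in> Hom_nr. \<forall>x\<in>U. T x \<in> V}" using T by blast
  qed
  then obtain Q where "openin hom_nr_topology Q" "(\<lambda>_. 0) \<in> Q"
    "Q \<subseteq> {T \<in> Hom_nr. \<forall>x\<in>U. T x \<in> V}"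
    using zero by (auto simp: eventually_nhdsin)
  then show ?thesis
    unfolding nbhd_of_def topspace_hom_nr_topology interior_of_def by blast
qed

text \<open>
  For the \<open>nr\<close>-boundedness: \<open>T\<close> maps some zero neighbourhood into a bounded set, which lies in a
  sumset of any zero neighbourhood that \<open>R\<close> maps to a bounded set.
\<close>

lemma Hom_nr_comp:
  fixes R T :: "'a::{lattice_ring, monoid_mult, topological_ab_group_add,
    topological_semigroup_mult} \<Rightarrow> 'a"
  assumes sg: "singletons_group_bounded (euclidean :: 'a topology)"
    and R: "R \<in> Hom_nr" and T: "T \<in> Hom_nr"
  shows "R \<circ> T \<in> Hom_nr"
proof -
  have add: "Modules.additive R" "Modules.additive T" using R T by (auto simp: Hom_nr_def)
  have "Modules.additive (R \<circ> T)"
    by standard (simp add: Modules.additive.add[OF add(1)] Modules.additive.add[OF add(2)])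
  moreover have "order_bounded_map (R \<circ> T)"
    using R T unfolding Hom_nr_def order_bounded_map_def
    by (simp only: mem_Collect_eq image_comp[symmetric]) blast
  moreover have "nr_bounded (R \<circ> T)"
  proof -
    obtain U where U: "zero_nbhd U" "ring_bounded euclidean 0 (*) (T ` U)"
      using T by (auto simp: Hom_nr_def nr_bounded_def)
    obtain V where V: "zero_nbhd V" "ring_bounded euclidean 0 (*) (R ` V)"
      using R by (auto simp: Hom_nr_def nr_bounded_def)
    obtain n where n: "T ` U \<subseteq> nfold_sum n V"
      using ring_bounded_subset_nfold_sum[OF sg U(2) V(1)] by blast
    have "R y \<in> nfold_sum n (R ` V)" if y: "y \<in> nfold_sum n V" for y
    proof -
      obtain e where e: "y = sum e {..<n}" "\<forall>i<n. e i \<in> V"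
        using y by (auto simp: nfold_sum_def)
      have "R y = (\<Sum>i<n. R (e i))" by (simp add: e(1) Modules.additive.sum[OF add(1)])
      then show ?thesis using e(2) unfolding nfold_sum_def by blast
    qed
    then have "(R \<circ> T) ` U \<subseteq> nfold_sum n (R ` V)" using n by auto
    then show ?thesis
      using U(1) ring_bounded_subset[OF ring_bounded_nfold_sum[OF V(2)]]
      unfolding nr_bounded_def by blast
  qed
  ultimately show ?thesis by (simp add: Hom_nr_def)
qed

section \<open>Suprema of elements from suprema of homomorphisms\<close>

text \<open>
  Let \<open>T\<close> be a small homomorphism and let \<open>N\<close> be a bounded zero neighbourhood. If \<open>T\<close> maps \<open>N\<close> into a
  small set \<open>V1\<close>, then \<open>d * T x\<close> is small for \<open>x \<in> N\<close>, uniformly in \<open>d \<in> D\<close>, because \<open>D\<close> is bounded.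
  To make \<open>T (d * x)\<close> small it is enough that \<open>T\<close> be small on the bounded set \<open>DN\<close> of products.
\<close>

lemma bounded_left_mults:
  fixes D :: "'a::{lattice_ring, monoid_mult, topological_ab_group_add,
    topological_semigroup_mult} set"
  assumes lb: "locally_bounded (euclidean :: 'a topology) 0 (*)"
    and sg: "singletons_group_bounded (euclidean :: 'a topology)"
    and D: "ring_bounded euclidean 0 (*) D"
  shows "ring_bounded hom_nr_topology (\<lambda>_. 0) (\<circ>) ((*) ` D)"
  unfolding ring_bounded_def
proof (intro conjI allI impI)
  show "(*) ` D \<subseteq> topspace hom_nr_topology"
    using left_mult_in_Hom_nr[OF lb] by (auto simp: topspace_hom_nr_topology)
  fix W :: "('a \<Rightarrow> 'a) set" assume W: "nbhd_of hom_nr_topology (\<lambda>_. 0) W"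
  obtain N :: "'a set" where N: "zero_nbhd N" "ring_bounded euclidean 0 (*) N"
    using lb unfolding locally_bounded_def by blast
  obtain V where V: "zero_nbhd V" "{T \<in> Hom_nr. \<forall>x\<in>N. T x \<in> V} \<subseteq> W"
    using hom_nr_nbhd_subset[OF W N(1)] by blast
  obtain V1 where V1: "zero_nbhd V1" "\<And>v d. v \<in> V1 \<Longrightarrow> d \<in> D \<Longrightarrow> d * v \<in> V"
    using ring_boundedD[OF D V(1)] by blast
  define DN where "DN = {d * x |d x. d \<in> D \<and> x \<in> N}"
  have DN: "ring_bounded euclidean 0 (*) DN"
    unfolding DN_def by (rule ring_bounded_mult[OF D N(2)])
  define Q1 where "Q1 = {T \<in> Hom_nr. \<forall>x\<in>N. T x \<in> V1}"
  define Q2 where "Q2 = {T \<in> Hom_nr. \<forall>x\<in>DN. T x \<in> V}"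
  have "nbhd_of hom_nr_topology (\<lambda>_. 0) Q1" "nbhd_of hom_nr_topology (\<lambda>_. 0) Q2"
    unfolding Q1_def Q2_def using hom_nr_nbhdI[OF lb sg] N(2) DN V(1) V1(1) by blast+
  then have "nbhd_of hom_nr_topology (\<lambda>_. 0) (Q1 \<inter> Q2)"
    by (auto simp: nbhd_of_def interior_of_Int)
  moreover have "T \<circ> (*) d \<in> W \<and> (*) d \<circ> T \<in> W" if T: "T \<in> Q1 \<inter> Q2" and d: "d \<in> D" for T d
  proof -
    have "T \<in> Hom_nr" using T by (simp add: Q1_def)
    then have "T \<circ> (*) d \<in> Hom_nr" "(*) d \<circ> T \<in> Hom_nr"
      using Hom_nr_comp[OF sg] left_mult_in_Hom_nr[OF lb] by blast+
    moreover have "T (d * x) \<in> V" if "x \<in> N" for x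
      using T d that by (auto simp: Q2_def DN_def)
    moreover have "d * T x \<in> V" if "x \<in> N" for x
      using T d that V1(2) by (auto simp: Q1_def)
    ultimately show ?thesis using V(2) by auto
  qed
  ultimately show "\<exists>Q. nbhd_of hom_nr_topology (\<lambda>_. 0) Q \<and>
      (\<forall>T\<in>Q. \<forall>L\<in>(*) ` D. T \<circ> L \<in> W \<and> L \<circ> T \<in> W)"
    by (intro exI[of _ "Q1 \<inter> Q2"]) simp
qed

lemma levi_of_hom_levi:
  assumes lb: "locally_bounded (euclidean :: 'a::{f_ring, monoid_mult,
      topological_ab_group_add, topological_semigroup_mult} topology) 0 (*)"
    and sg: "singletons_group_bounded (euclidean :: 'a topology)"
    and hom: "levi_property (hom_nr_topology :: ('a \<Rightarrow> 'a) topology) (\<lambda>_. 0) (\<circ>) hom_le"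
  shows "levi_property (euclidean :: 'a topology) 0 (*) (\<le>)"
  unfolding levi_property_def
proof (intro allI impI)
  fix D :: "'a set"
  assume D: "ring_bounded euclidean 0 (*) D" "upward_directed (\<le>) D" "\<forall>x\<in>D. 0 \<le> x"
  have le_iff: "hom_le ((*) c) ((*) d) \<longleftrightarrow> c \<le> d" for c d :: 'a
    using f_ring_zero_le_one[where 'a = 'a]
    by (auto simp: hom_le_def mult_right_mono dest: spec[of _ 1])
  have "upward_directed hom_le ((*) ` D)"
    using D(2) by (simp add: upward_directed_def le_iff)
  moreover have "\<forall>L\<in>(*) ` D. hom_le (\<lambda>_. 0) L"
    using D(3) by (auto simp: hom_le_def)
  ultimately obtain S where "is_supremum Hom_nr hom_le ((*) ` D) S"
    using hom bounded_left_mults[OF lb sg D(1)]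
    unfolding levi_property_def topspace_hom_nr_topology by blast
  then have ub: "\<And>d. d \<in> D \<Longrightarrow> hom_le ((*) d) S"
    and least: "\<And>u. (\<forall>d\<in>D. hom_le ((*) d) ((*) u)) \<Longrightarrow> hom_le S ((*) u)"
    using left_mult_in_Hom_nr[OF lb] by (auto simp: is_supremum_def)
  have "is_supremum UNIV (\<le>) D (S 1)"
    unfolding is_supremum_def
  proof (intro conjI ballI impI)
    show "d \<le> S 1" if "d \<in> D" for d
      using ub[OF that] f_ring_zero_le_one[where 'a = 'a] by (auto simp: hom_le_def dest: spec[of _ 1])
    show "S 1 \<le> u" if "\<forall>d\<in>D. d \<le> u" for u
    proof -
      have "hom_le S ((*) u)" using least that by (simp add: le_iff)
      then show ?thesis
        using f_ring_zero_le_one[where 'a = 'a] by (auto simp: hom_le_def dest: spec[of _ 1])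
    qed
  qed simp
  then show "\<exists>s. is_supremum (topspace euclidean) (\<le>) D s" by auto
qed

section \<open>Suprema of homomorphisms from suprema of elements\<close>

text \<open>
  For positive \<open>R\<close> and \<open>1 = e\<^sub>1 + \<dots> + e\<^sub>n\<close> one has
  \<open>\<bar>R y\<bar> \<le> R \<bar>y\<bar> = R (e\<^sub>1 * \<bar>y\<bar> + \<dots> + e\<^sub>n * \<bar>y\<bar>) \<le> R (\<bar>e\<^sub>1\<bar> * \<bar>y\<bar>) + \<dots> + R (\<bar>e\<^sub>n\<bar> * \<bar>y\<bar>)\<close>.
  The bound depends on \<open>R\<close> only through the values on the products \<open>\<bar>e\<^sub>i\<bar> * \<bar>y\<bar>\<close>, so it serves both
  for the members of a directed family and for their supremum.
\<close>

lemma positive_additive_dominated: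
  fixes R :: "'a::{lattice_ring, monoid_mult} \<Rightarrow> 'a"
  assumes R: "Modules.additive R" "\<And>x. 0 \<le> x \<Longrightarrow> 0 \<le> R x"
    and small: "\<And>e. e \<in> E \<Longrightarrow> R (\<bar>e\<bar> * \<bar>y\<bar>) \<in> N"
    and one: "1 \<in> nfold_sum n E"
  shows "\<exists>b\<in>nfold_sum n {v \<in> N. 0 \<le> v}. \<bar>R y\<bar> \<le> b"
proof -
  obtain e where e: "1 = sum e {..<n}" "\<And>i. i < n \<Longrightarrow> e i \<in> E"
    using one by (auto simp: nfold_sum_def)
  have "\<bar>R y\<bar> \<le> R \<bar>y\<bar>" by (rule additive_abs_le[OF R])
  also have "\<bar>y\<bar> = (\<Sum>i<n. e i * \<bar>y\<bar>)"
    by (metis e(1) mult_1 sum_distrib_right)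
  also have "R \<dots> \<le> R (\<Sum>i<n. \<bar>e i\<bar> * \<bar>y\<bar>)"
    by (intro additive_mono[OF R] sum_mono mult_right_mono abs_ge_self abs_ge_zero)
  also have "\<dots> = (\<Sum>i<n. R (\<bar>e i\<bar> * \<bar>y\<bar>))"
    by (rule Modules.additive.sum[OF R(1)])
  finally have le: "\<bar>R y\<bar> \<le> (\<Sum>i<n. R (\<bar>e i\<bar> * \<bar>y\<bar>))" .
  have "\<forall>i<n. R (\<bar>e i\<bar> * \<bar>y\<bar>) \<in> {v \<in> N. 0 \<le> v}"
    using small e(2) R(2) by simp
  then have "(\<Sum>i<n. R (\<bar>e i\<bar> * \<bar>y\<bar>)) \<in> nfold_sum n {v \<in> N. 0 \<le> v}"
    unfolding nfold_sum_def by blast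
  then show ?thesis using le by blast
qed

text \<open>
  For small \<open>e\<close> the homomorphism \<open>L\<^sub>e\<close> is small, since \<open>N\<close> is bounded. The boundedness of \<open>D\<close> then
  makes \<open>T \<circ> L\<^sub>e\<close> map \<open>N\<close> into \<open>N\<close> for all \<open>T \<in> D\<close>.
\<close>

lemma uniformly_small_on_products:
  fixes D :: "('a::{lattice_ring, monoid_mult, topological_ab_group_add,
    topological_semigroup_mult} \<Rightarrow> 'a) set"
  assumes lb: "locally_bounded (euclidean :: 'a topology) 0 (*)"
    and sg: "singletons_group_bounded (euclidean :: 'a topology)"
    and D: "ring_bounded hom_nr_topology (\<lambda>_. 0) (\<circ>) D"
    and N: "zero_nbhd N" "ring_bounded euclidean 0 (*) N"
  shows "\<exists>E. zero_nbhd E \<and> (\<forall>T\<in>D. \<forall>e\<in>E. \<forall>y\<in>N. T (e * y) \<in> N)"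
proof -
  have "nbhd_of hom_nr_topology (\<lambda>_. 0) {T \<in> Hom_nr. \<forall>x\<in>N. T x \<in> N}"
    by (rule hom_nr_nbhdI[OF lb sg N(2,1)])
  then obtain Q where Q: "nbhd_of hom_nr_topology (\<lambda>_. 0) Q"
    and QD: "\<forall>R\<in>Q. \<forall>T\<in>D. T \<circ> R \<in> {T \<in> Hom_nr. \<forall>x\<in>N. T x \<in> N}"
    using D unfolding ring_bounded_def by meson
  have small: "T (R x) \<in> N" if "R \<in> Q" "T \<in> D" "x \<in> N" for R T x
    using bspec[OF bspec[OF QD that(1)] that(2)] that(3) by simp
  obtain V where V: "zero_nbhd V" "{T \<in> Hom_nr. \<forall>x\<in>N. T x \<in> V} \<subseteq> Q"
    using hom_nr_nbhd_subset[OF Q N(1)] by blast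
  obtain E where E: "zero_nbhd E" "\<forall>e\<in>E. \<forall>y\<in>N. e * y \<in> V"
    using ring_boundedD[OF N(2) V(1)] by blast
  have "(*) e \<in> Q" if "e \<in> E" for e
    using E(2) V(2) that left_mult_in_Hom_nr[OF lb, of e] by blast
  then show ?thesis using E(1) small by blast
qed

text \<open>
  For \<open>\<ge>\<close>, two members \<open>T\<close> and \<open>R\<close> have a common upper bound \<open>P\<close> in \<open>D\<close>, so that
  \<open>T x + R y \<le> P (x + y)\<close>.
\<close>

lemma directed_sup_additive:
  fixes D :: "('a::{lattice_ring, conditionally_complete_lattice} \<Rightarrow> 'a) set"
  assumes add: "\<And>T. T \<in> D \<Longrightarrow> Modules.additive T"
    and dir: "upward_directed hom_le D"
    and bdd: "\<And>x. 0 \<le> x \<Longrightarrow> bdd_above ((\<lambda>T. T x) ` D)"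
    and x: "0 \<le> x" and y: "0 \<le> y"
  shows "(SUP T\<in>D. T (x + y)) = (SUP T\<in>D. T x) + (SUP T\<in>D. T y)"
proof (rule antisym)
  have ne: "D \<noteq> {}" using dir by (simp add: upward_directed_def)
  note upper = cSUP_upper[OF _ bdd]
  show "(SUP T\<in>D. T (x + y)) \<le> (SUP T\<in>D. T x) + (SUP T\<in>D. T y)"
  proof (rule cSUP_least[OF ne])
    fix T assume T: "T \<in> D"
    show "T (x + y) \<le> (SUP T\<in>D. T x) + (SUP T\<in>D. T y)"
      unfolding Modules.additive.add[OF add[OF T]]
      by (rule add_mono[OF upper[OF T x] upper[OF T y]])
  qed
  have le: "T x + R y \<le> (SUP T\<in>D. T (x + y))" if TR: "T \<in> D" "R \<in> D" for T R
  proof -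
    obtain P where P: "P \<in> D" "hom_le T P" "hom_le R P"
      using dir TR unfolding upward_directed_def by meson
    have "T x + R y \<le> P x + P y"
      using P(2,3) x y by (intro add_mono) (auto simp: hom_le_def)
    also have "\<dots> = P (x + y)" by (simp add: Modules.additive.add[OF add[OF P(1)]])
    also have "\<dots> \<le> (SUP T\<in>D. T (x + y))" by (rule upper[OF P(1) add_nonneg_nonneg[OF x y]])
    finally show ?thesis .
  qed
  have "(SUP T\<in>D. T x) \<le> (SUP T\<in>D. T (x + y)) - R y" if R: "R \<in> D" for R
    by (rule cSUP_least[OF ne]) (use le[OF _ R] in \<open>simp only: le_diff_eq\<close>)
  then have "R y \<le> (SUP T\<in>D. T (x + y)) - (SUP T\<in>D. T x)" if "R \<in> D" for R
    using that by (simp only: le_diff_eq add.commute)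
  then have "(SUP T\<in>D. T y) \<le> (SUP T\<in>D. T (x + y)) - (SUP T\<in>D. T x)"
    by (rule cSUP_least[OF ne])
  then show "(SUP T\<in>D. T x) + (SUP T\<in>D. T y) \<le> (SUP T\<in>D. T (x + y))"
    by (simp only: le_diff_eq add.commute)
qed

text \<open>
  The Levi property of the ring bounds \<open>{T x | T \<in> D}\<close> from above for each \<open>x \<ge> 0\<close>, and order
  completeness then provides the pointwise supremum; the Fatou property makes it \<open>nr\<close>-bounded.
\<close>

lemma hom_levi_of_levi:
  assumes sg: "singletons_group_bounded (euclidean ::
      'a::{lattice_ring, monoid_mult, conditionally_complete_lattice,
           topological_ab_group_add, topological_semigroup_mult} topology)"
    and ls: "locally_solid (euclidean :: 'a topology)"
    and lb: "locally_bounded (euclidean :: 'a topology) 0 (*)"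
    and fatou: "fatou_property (euclidean :: 'a topology)"
    and levi: "levi_property (euclidean :: 'a topology) 0 (*) (\<le>)"
  shows "levi_property (hom_nr_topology :: ('a \<Rightarrow> 'a) topology) (\<lambda>_. 0) (\<circ>) hom_le"
  unfolding levi_property_def topspace_hom_nr_topology
proof (intro allI impI)
  fix D :: "('a \<Rightarrow> 'a) set"
  assume D: "ring_bounded hom_nr_topology (\<lambda>_. 0) (\<circ>) D"
    and dir: "upward_directed hom_le D" and "\<forall>T\<in>D. hom_le (\<lambda>_. 0) T"
  then have add: "\<And>T. T \<in> D \<Longrightarrow> Modules.additive T"
    and pos: "\<And>T x. T \<in> D \<Longrightarrow> 0 \<le> x \<Longrightarrow> 0 \<le> T x" and ne: "D \<noteq> {}"
    by (auto simp: ring_bounded_def topspace_hom_nr_topology Hom_nr_def hom_le_def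
        upward_directed_def)
  obtain N0 :: "'a set" where N0: "zero_nbhd N0" "ring_bounded euclidean 0 (*) N0"
    using lb unfolding locally_bounded_def by blast
  obtain N where N: "zero_nbhd N" "N \<subseteq> N0" "solid N" "order_closed N"
    using fatou N0(1) unfolding fatou_property_def by blast
  have Nb: "ring_bounded euclidean 0 (*) N" by (rule ring_bounded_subset[OF N0(2) N(2)])
  obtain E0 where E0: "zero_nbhd E0" "\<And>T e y. T \<in> D \<Longrightarrow> e \<in> E0 \<Longrightarrow> y \<in> N \<Longrightarrow> T (e * y) \<in> N"
    using uniformly_small_on_products[OF lb sg D N(1) Nb] by blast
  obtain E where E: "zero_nbhd E" "E \<subseteq> E0" "solid E"
    using locally_solidD[OF ls E0(1)] by blast
  have small: "T (\<bar>e\<bar> * \<bar>y\<bar>) \<in> N" if "T \<in> D" "e \<in> E" "y \<in> N" for T e y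
    using E0(2)[of T "\<bar>e\<bar>" "\<bar>y\<bar>"] that E(2) solidD[OF E(3) that(2), of "\<bar>e\<bar>"]
      solidD[OF N(3) that(3), of "\<bar>y\<bar>"] by auto
  obtain n where n: "1 \<in> nfold_sum n E"
    using sg E(1) unfolding singletons_group_bounded_def by fastforce
  define H where "H = {y. \<exists>b\<in>nfold_sum n {v \<in> N. 0 \<le> v}. \<bar>y\<bar> \<le> b}"
  have Hb: "ring_bounded euclidean 0 (*) H"
    unfolding H_def
  proof (rule ring_bounded_dominated[OF ls])
    show "ring_bounded euclidean 0 (*) (nfold_sum n {v \<in> N. 0 \<le> v})"
      by (intro ring_bounded_nfold_sum ring_bounded_subset[OF Nb]) blast
    show "0 \<le> b" if "b \<in> nfold_sum n {v \<in> N. 0 \<le> v}" for b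
      using that by (auto simp: nfold_sum_def intro!: sum_nonneg)
  qed
  have DH: "T y \<in> H" if T: "T \<in> D" and y: "y \<in> N" for T y
    unfolding H_def
    using positive_additive_dominated[OF add[OF T] pos[OF T] small[OF T _ y] n] by simp
  have dir_at: "upward_directed (\<le>) ((\<lambda>T. T x) ` D)" if x: "0 \<le> x" for x
    unfolding upward_directed_def
  proof (intro conjI ballI)
    show "(\<lambda>T. T x) ` D \<noteq> {}" using ne by simp
    fix a b assume "a \<in> (\<lambda>T. T x) ` D" "b \<in> (\<lambda>T. T x) ` D"
    then obtain T R where TR: "T \<in> D" "a = T x" "R \<in> D" "b = R x" by blast
    then obtain P where P: "P \<in> D" "hom_le T P" "hom_le R P"
      using dir unfolding upward_directed_def by meson
    then show "\<exists>w\<in>(\<lambda>T. T x) ` D. a \<le> w \<and> b \<le> w"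
      using TR x by (intro bexI[of _ "P x"]) (auto simp: hom_le_def)
  qed
  (* An arbitrary x need not lie in N, but it is a finite sum of elements of N. *)
  have bdd: "bdd_above ((\<lambda>T. T x) ` D)" if x: "0 \<le> x" for x
  proof -
    obtain m where "x \<in> nfold_sum m N"
      using sg N(1) unfolding singletons_group_bounded_def by fastforce
    then obtain f where f: "x = sum f {..<m}" "\<forall>j<m. f j \<in> N"
      by (auto simp: nfold_sum_def)
    have "T x \<in> nfold_sum m H" if "T \<in> D" for T
    proof -
      have "T x = (\<Sum>j<m. T (f j))" by (simp add: f(1) Modules.additive.sum[OF add[OF that]])
      then show ?thesis using DH[OF that] f(2) unfolding nfold_sum_def by blast
    qed
    then have "ring_bounded euclidean 0 (*) ((\<lambda>T. T x) ` D)"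
      by (intro ring_bounded_subset[OF ring_bounded_nfold_sum[OF Hb]]) blast
    then obtain s where "is_supremum UNIV (\<le>) ((\<lambda>T. T x) ` D) s"
      using levi dir_at[OF x] pos[OF _ x] unfolding levi_property_def topspace_euclidean
      by (metis (no_types, lifting) imageE)
    then show ?thesis by (auto simp: is_supremum_def intro!: bdd_aboveI)
  qed
  have "(SUP T\<in>D. T (x + y)) = (SUP T\<in>D. T x) + (SUP T\<in>D. T y)" if "0 \<le> x" "0 \<le> y" for x y
    by (rule directed_sup_additive[OF _ dir _ that]) (fact add bdd)+
  from additive_extension_from_cone[of "\<lambda>x. SUP T\<in>D. T x", OF this]
  obtain S where S: "Modules.additive S" "\<And>x. 0 \<le> x \<Longrightarrow> S x = (SUP T\<in>D. T x)"
    by blast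
  have upper: "T x \<le> S x" if "T \<in> D" "0 \<le> x" for T x
    unfolding S(2)[OF that(2)] by (rule cSUP_upper[OF that(1) bdd[OF that(2)]])
  have least: "S x \<le> u" if "0 \<le> x" "\<And>T. T \<in> D \<Longrightarrow> T x \<le> u" for x u
    unfolding S(2)[OF that(1)] by (rule cSUP_least[OF ne that(2)])
  have Spos: "0 \<le> S x" if "0 \<le> x" for x
  proof -
    obtain T where T: "T \<in> D" using ne by blast
    show ?thesis by (rule order_trans[OF pos[OF T that] upper[OF T that]])
  qed
  have "S (\<bar>e\<bar> * \<bar>y\<bar>) \<in> N" if "e \<in> E" "y \<in> N" for e y
  proof (rule order_closed_directed_sup[OF N(4)])
    let ?x = "\<bar>e\<bar> * \<bar>y\<bar>"
    have x: "0 \<le> ?x" by simp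
    show "(\<lambda>T. T ?x) ` D \<subseteq> N" using small that by blast
    show "upward_directed (\<le>) ((\<lambda>T. T ?x) ` D)" by (rule dir_at[OF x])
    show "is_supremum UNIV (\<le>) ((\<lambda>T. T ?x) ` D) (S ?x)"
      using upper[OF _ x] least[OF x] by (auto simp: is_supremum_def)
  qed
  then have "S y \<in> H" if y: "y \<in> N" for y
    unfolding H_def using positive_additive_dominated[OF S(1) Spos _ n] y by simp
  then have "nr_bounded S"
    using N(1) ring_bounded_subset[OF Hb, of "S ` N"] unfolding nr_bounded_def by blast
  then have "S \<in> Hom_nr"
    using S(1) positive_additive_order_bounded[OF S(1) Spos] by (simp add: Hom_nr_def)
  then have "is_supremum Hom_nr hom_le D S"
    using upper least by (auto simp: is_supremum_def hom_le_def)
  then show "\<exists>s. is_supremum Hom_nr hom_le D s" by blast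
qed

theorem corollary8:
  assumes "singletons_group_bounded (euclidean ::
      'a::{f_ring, monoid_mult, conditionally_complete_lattice,
           topological_ab_group_add, topological_semigroup_mult} topology)"
    and "locally_solid (euclidean :: 'a topology)"
    and "locally_bounded (euclidean :: 'a topology) 0 (*)"
    and "fatou_property (euclidean :: 'a topology)"
  shows "levi_property (hom_nr_topology :: ('a \<Rightarrow> 'a) topology) (\<lambda>_. 0) (\<circ>) hom_le
     \<longleftrightarrow> levi_property (euclidean :: 'a topology) 0 (*) (\<le>)"
  using levi_of_hom_levi[OF assms(3,1)] hom_levi_of_levi[OF assms(1-4)] by blast

end
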